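(* Let $(S,\rho)$ be a separable metric space and let $X, X_1,X_2,\ldots$ be i.i.d. random elements of $S$ with common distribution $\mu$. Suppose that $$\mu(\{y\in S:\rho(x,y)=r\})=0\qquad\text{for all } x\in S,\ r\ge 0.$$ Fix an integer $k\ge 1$ and $t\in\mathbb{R}$. Then, as $n\to\infty$, $$\mathbb{E}[C_{n,k}] = e^{-t}+O\left(\frac{\log\log n}{\log n}\right).$$
   Context: For $x\in S$ and $r\ge 0$, $B(x,r)=\{y\in S:\rho(x,y)\le r\}$ is the closed ball. For $k\le n-1$ and $i\in\{1,\ldots,n\}$, $R_{i,n,k}$ denotes the distance of $X_i$ to its $k$th-nearest neighbor among $\{X_1,\ldots,X_n\}\setminus\{X_i\}$, i.e. the $k$th smallest of the distances $\rho(X_i,X_j)$, $j\in\{1,\ldots,n\}\setminus\{i\}$ (these are almost surely pairwise distinct under the hypothesis on $\mu$). Put $$v_{n,k}=v_{n,k}(t)=\frac{t+\log n+(k-1)\log\log n-\log (k-1)!}{n},\qquad C_{n,k}=\sum_{i=1}^n \mathbf{1}\{\mu(B(X_i,R_{i,n,k}))>v_{n,k}\}.$$ Here $\mathbf{1}\{A\}$ is the indicator of $A$. The notation $a_n=O(b_n)$ means $|a_n|\le C|b_n|$ for some positive constant $C$ not depending on $n$ (for all sufficiently large $n$). *)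

theory Defs
  imports "HOL-Probability.Probability" "HOL-Library.Landau_Symbols"
begin

(* The distance from x i to its k-th nearest neighbour among x 1, ..., x n without x i.
   Sorting a list keeps multiplicities, so tied distances are counted separately.
   Meaningful for 1 <= i <= n and 1 <= k <= n - 1 only; otherwise the value is arbitrary. *)
definition knn_dist :: "(nat \<Rightarrow> 'a::metric_space) \<Rightarrow> nat \<Rightarrow> nat \<Rightarrow> nat \<Rightarrow> real" where
  "knn_dist x i n k =
     sort (map (\<lambda>j. dist (x i) (x j)) (filter (\<lambda>j. j \<noteq> i) [1..<Suc n])) ! (k - 1)"

definition knn_threshold :: "real \<Rightarrow> nat \<Rightarrow> nat \<Rightarrow> real" where
  "knn_threshold t n k =
     (t + ln (real n) + (real k - 1) * ln (ln (real n)) - ln (fact (k - 1))) / real n"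

definition exceedance_count ::
    "'a::metric_space measure \<Rightarrow> real \<Rightarrow> (nat \<Rightarrow> 'a) \<Rightarrow> nat \<Rightarrow> nat \<Rightarrow> real" where
  "exceedance_count \<mu> t x n k =
     (\<Sum>i=1..n. of_bool (measure \<mu> (cball (x i) (knn_dist x i n k)) > knn_threshold t n k))"

end

theory Submission
  imports Defs "HOL-Real_Asymp.Real_Asymp"
begin

text \<open>
  Write \<open>F\<^sub>y(r)\<close> for the mass of the closed ball of radius \<open>r\<close> about \<open>y\<close>. It is monotone in \<open>r\<close>, so
  the ball of \<open>X\<^sub>i\<close> reaching to its \<open>k\<close>-th neighbour has mass above \<open>v\<close> exactly if fewer than \<open>k\<close> of
  the other points satisfy \<open>F\<^sub>y(\<rho>(y, X\<^sub>j)) \<le> v\<close> with \<open>y = X\<^sub>i\<close>. Spheres are null sets, so \<open>F\<^sub>y\<close> is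
  continuous and each of these events has probability \<open>v\<close> given \<open>X\<^sub>i = y\<close>, whatever \<open>y\<close> is. Hence the
  expectation is exactly \<open>n\<close> times the probability that a binomial variable with parameters \<open>n - 1\<close> and
  \<open>v\<close> is less than \<open>k\<close>. At the threshold the term \<open>k - 1\<close> contributes \<open>exp(-t)\<close>, and the
  lower terms are smaller by powers of \<open>ln n\<close>.
\<close>

section \<open>Convergence at a common rate under products\<close>

text \<open>Splits \<open>f h - a b\<close> into \<open>(f - a) h + a (h - b)\<close>; since
  \<open>g\<close> is bounded, so is \<open>h\<close>, and the first summand keeps the rate
  \<open>g\<close>.\<close>

lemma bigo_diff_mult:
  fixes f h g :: "'b \<Rightarrow> real"
  assumes "g \<in> O[F](\<lambda>_. 1)" "(\<lambda>x. f x - a) \<in> O[F](g)" "(\<lambda>x. h x - b) \<in> O[F](g)"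
  shows "(\<lambda>x. f x * h x - a * b) \<in> O[F](g)"
proof -
  have "(\<lambda>x. (h x - b) + b) \<in> O[F](\<lambda>_. 1)"
    by (intro sum_in_bigo landau_o.big_trans[OF assms(3,1)]) simp
  then have "(\<lambda>x. (f x - a) * h x) \<in> O[F](\<lambda>x. g x * 1)"
    using assms(2) by (intro landau_o.big.mult) simp_all
  moreover have "(\<lambda>x. a * (h x - b)) \<in> O[F](g)"
    using assms(3) by simp
  ultimately have "(\<lambda>x. (f x - a) * h x + a * (h x - b)) \<in> O[F](g)"
    by (intro sum_in_bigo) simp_all
  then show ?thesis
    by (simp add: algebra_simps)
qed

lemma bigo_diff_prod:
  fixes f :: "'c \<Rightarrow> 'b \<Rightarrow> real"
  assumes "finite A" "g \<in> O[F](\<lambda>_. 1)" "\<And>i. i \<in> A \<Longrightarrow> (\<lambda>x. f i x - a i) \<in> O[F](g)"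
  shows "(\<lambda>x. (\<Prod>i\<in>A. f i x) - (\<Prod>i\<in>A. a i)) \<in> O[F](g)"
  using assms(1,3)
proof (induction A rule: finite_induct)
  case (insert i A)
  then have "(\<lambda>x. f i x * (\<Prod>i\<in>A. f i x) - a i * (\<Prod>i\<in>A. a i)) \<in> O[F](g)"
    by (intro bigo_diff_mult assms(2)) auto
  with insert show ?case by simp
qed simp

lemma bigo_diff_power:
  fixes f :: "'b \<Rightarrow> real"
  assumes "g \<in> O[F](\<lambda>_. 1)" "(\<lambda>x. f x - a) \<in> O[F](g)"
  shows "(\<lambda>x. f x ^ m - a ^ m) \<in> O[F](g)"
  using bigo_diff_prod[of "{..<m}" g F "\<lambda>_. f" "\<lambda>_. a"] assms by simp

section \<open>Asymptotics of the binomial tail at the threshold\<close>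

text \<open>Gathers the constants and replaces \<open>real k - 1\<close> by
  \<open>real (k - 1)\<close>, so that the coefficient of \<open>ln (ln (real n))\<close> can later
  become a natural exponent.\<close>

lemma knn_threshold_eq:
  "k \<ge> 1 \<Longrightarrow> knn_threshold t n k =
     (t - ln (fact (k - 1)) + ln (real n) + real (k - 1) * ln (ln (real n))) / real n"
  by (simp add: knn_threshold_def of_nat_diff algebra_simps)

lemma knn_threshold_eventually:
  assumes "k \<ge> 1"
  shows "eventually (\<lambda>n. 0 \<le> knn_threshold t n k \<and> knn_threshold t n k < 1) sequentially"
proof -
  have "eventually (\<lambda>n. 0 \<le> (s + ln (real n) + c * ln (ln (real n))) / real n) sequentially"
    "eventually (\<lambda>n. (s + ln (real n) + c * ln (ln (real n))) / real n < 1) sequentially" for s c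
    by real_asymp+
  then show ?thesis
    unfolding knn_threshold_eq[OF assms] by eventually_elim simp
qed

text \<open>For \<open>j > N\<close> the binomial coefficient is 0, so the truncated exponent
  \<open>N - j\<close> is harmless.\<close>

definition binomial_lower_tail :: "nat \<Rightarrow> real \<Rightarrow> nat \<Rightarrow> real" where
  "binomial_lower_tail N p k = (\<Sum>j<k. real (N choose j) * p ^ j * (1 - p) ^ (N - j))"

text \<open>Since \<open>n v\<close> is \<open>ln n\<close> up to lower order and
  \<open>n (1 - v)^n\<close> is close to \<open>exp (- s) / (ln n)^(k - 1)\<close> with
  \<open>s = t - ln (fact (k - 1))\<close>, the term behaves like
  \<open>exp (- s) (ln n)^(j - k + 1) / j!\<close>. The rate bounds both the relative deviation of
  \<open>n v\<close> from \<open>ln n\<close> and the size \<open>1 / ln n\<close> of the next lower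
  term.\<close>

lemma binomial_term_asymp:
  fixes t :: real
  assumes "k \<ge> 1" "j < k"
  defines "v \<equiv> \<lambda>n. knn_threshold t n k"
  shows "(\<lambda>n. real n * (real (n - 1 choose j) * v n ^ j * (1 - v n) ^ (n - 1 - j))
            - (if j = k - 1 then exp (- t) else 0)) \<in> O(\<lambda>n. ln (ln (real n)) / ln (real n))"
proof -
  define g where "g = (\<lambda>n::nat. ln (ln (real n)) / ln (real n))"
  define s c where "s = t - ln (fact (k - 1))" and "c = real (k - 1)"
  have v: "v n = (s + ln (real n) + c * ln (ln (real n))) / real n" for n
    unfolding v_def s_def c_def using knn_threshold_eq[OF assms(1)] .
  have g1: "g \<in> O(\<lambda>_. 1)"
    unfolding g_def by real_asymp
  \<comment> \<open>For large \<open>n\<close> the term equals \<open>P Q^j R^(j+1) T D / j!\<close>, and each factor converges at rate \<open>g\<close>.\<close>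
  define P where "P = (\<lambda>n. \<Prod>i\<in>{0..<j}. (real n - 1 - real i) / real n)"
  define Q where "Q = (\<lambda>n. (s + ln (real n) + c * ln (ln (real n))) / ln (real n))"
  define R where "R = (\<lambda>n. 1 / (1 - v n))"
  \<comment> \<open>\<open>T\<close> is \<open>n (1 - v)^n (ln n)^(k - 1)\<close> in exponential
    form; as \<open>n v = s + ln n + c ln (ln n)\<close>, its exponent tends to
    \<open>-s\<close>.\<close>
  define T where "T = (\<lambda>n::nat. exp (real n * ln (1 - v n) + ln (real n) + c * ln (ln (real n))))"
  define D where "D = (\<lambda>n::nat. (1 / ln (real n)) ^ (k - 1 - j))"
  define \<delta> where "\<delta> = (if j = k - 1 then 1 else 0 :: real)"
  have "(\<lambda>n. (real n - 1 - x) / real n - 1) \<in> O(g)" for x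
    unfolding g_def by real_asymp
  then have "(\<lambda>n. P n - (\<Prod>i\<in>{0..<j}. 1)) \<in> O(g)"
    unfolding P_def by (intro bigo_diff_prod g1) auto
  then have P: "(\<lambda>n. P n - 1) \<in> O(g)" by simp
  have "(\<lambda>n. Q n - 1) \<in> O(g)"
    unfolding Q_def g_def by real_asymp
  from bigo_diff_power[OF g1 this] have Q: "(\<lambda>n. Q n ^ j - 1) \<in> O(g)" by simp
  have "(\<lambda>n. R n - 1) \<in> O(g)"
    unfolding R_def v g_def by real_asymp
  from bigo_diff_power[OF g1 this, of "Suc j"] have R: "(\<lambda>n. R n ^ Suc j - 1) \<in> O(g)" by simp
  have T: "(\<lambda>n. T n - exp (- s)) \<in> O(g)"
    unfolding T_def v g_def by real_asymp
  have D: "(\<lambda>n. D n - \<delta>) \<in> O(g)"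
  proof (cases "j = k - 1")
    case False
    with assms(2) have "k - 1 - j \<noteq> 0" by arith
    then obtain m where m: "k - 1 - j = Suc m" by (metis not0_implies_Suc)
    \<comment> \<open>One factor \<open>1 / ln n\<close> supplies the rate; the remaining
      \<open>m\<close> only need to be bounded.\<close>
    have "(\<lambda>n::nat. 1 / ln (real n)) \<in> O(g)" "(\<lambda>n::nat. 1 / ln (real n)) \<in> O(\<lambda>_. 1)"
      unfolding g_def by real_asymp+
    then have "(\<lambda>n. 1 / ln (real n) * (1 / ln (real n)) ^ m) \<in> O(\<lambda>n. g n * 1 ^ m)"
      by (intro landau_o.big.mult landau_o.big_power)
    with False m show ?thesis by (simp add: D_def \<delta>_def)
  qed (simp add: D_def \<delta>_def)
  have "(\<lambda>n. P n * (Q n ^ j * (R n ^ Suc j * (T n * D n))) - 1 * (1 * (1 * (exp (- s) * \<delta>)))) \<in> O(g)"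
    by (intro bigo_diff_mult g1 P Q R T D)
  then have "(\<lambda>n. 1 / fact j * (P n * (Q n ^ j * (R n ^ Suc j * (T n * D n))) - exp (- s) * \<delta>)) \<in> O(g)"
    by (subst landau_o.big.cmult_in_iff) simp_all
  also have "?this \<longleftrightarrow> (\<lambda>n. real n * (real (n - 1 choose j) * v n ^ j * (1 - v n) ^ (n - 1 - j))
            - (if j = k - 1 then exp (- t) else 0)) \<in> O(g)"
  proof (rule landau_o.big.in_cong)
    have l: "eventually (\<lambda>n::nat. ln (real n) > 0) sequentially" by real_asymp
    show "eventually (\<lambda>n. 1 / fact j * (P n * (Q n ^ j * (R n ^ Suc j * (T n * D n))) - exp (- s) * \<delta>) =
        real n * (real (n - 1 choose j) * v n ^ j * (1 - v n) ^ (n - 1 - j))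
            - (if j = k - 1 then exp (- t) else 0)) sequentially"
      using l knn_threshold_eventually[OF assms(1), of t] eventually_gt_at_top[of k]
    proof eventually_elim
      case (elim n)
      have v1: "v n < 1" using elim by (simp add: v_def)
      have n0: "real n > 0" using elim by simp
      \<comment> \<open>For \<open>j = k - 1\<close> the factorial in
        \<open>exp (- s) = fact (k - 1) * exp (- t)\<close> cancels \<open>fact j\<close>; this is
        the purpose of \<open>ln (fact (k - 1))\<close> in the threshold.\<close>
      have e: "exp (- s) * \<delta> / fact j = (if j = k - 1 then exp (- t) else 0)"
        by (simp add: \<delta>_def s_def exp_diff exp_minus field_simps)
      have "real (n - 1 choose j) = (\<Prod>i\<in>{0..<j}. (real n - 1 - real i)) / fact j"
        using elim by (simp add: binomial_gbinomial gbinomial_prod_rev of_nat_diff)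
      then have b: "real (n - 1 choose j) = P n * real n ^ j / fact j"
        using n0 by (simp add: P_def prod_dividef)
      have q: "Q n = v n * real n / ln (real n)"
        using n0 by (simp add: Q_def v)
      have T: "T n = (1 - v n) ^ n * real n * ln (real n) ^ (k - 1)"
        using elim v1 n0 by (simp add: T_def exp_add c_def exp_of_nat_mult)
      \<comment> \<open>\<open>R n ^ Suc j\<close> lowers the exponent from \<open>n\<close> to
        \<open>n - 1 - j\<close>, the number of failures.\<close>
      have "(1 - v n) ^ n = (1 - v n) ^ (n - 1 - j) * (1 - v n) ^ Suc j"
        using elim assms(2) by (subst power_add[symmetric]) simp
      then have r: "R n ^ Suc j * (1 - v n) ^ n = (1 - v n) ^ (n - 1 - j)"
        using v1 by (simp add: R_def power_divide)
      have "ln (real n) ^ (k - 1) = ln (real n) ^ (k - 1 - j) * ln (real n) ^ j"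
        using assms(2) by (subst power_add[symmetric]) simp
      then have d: "D n * ln (real n) ^ (k - 1) = ln (real n) ^ j"
        using elim by (simp add: D_def power_divide)
      have "P n * (Q n ^ j * (R n ^ Suc j * (T n * D n))) / fact j
          = P n / fact j * Q n ^ j * (R n ^ Suc j * (1 - v n) ^ n) * real n
             * (D n * ln (real n) ^ (k - 1))"
        unfolding T by simp
      also have "\<dots> = real n * (real (n - 1 choose j) * v n ^ j * (1 - v n) ^ (n - 1 - j))"
        unfolding r d unfolding b q using elim by (simp add: field_simps)
      finally show ?case
        using e by (simp add: algebra_simps diff_divide_distrib)
    qed
  qed
  finally show ?thesis unfolding g_def .
qed

lemma binomial_lower_tail_asymp:
  assumes "k \<ge> 1"
  shows "(\<lambda>n. real n * binomial_lower_tail (n - 1) (knn_threshold t n k) k - exp (- t))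
           \<in> O(\<lambda>n. ln (ln (real n)) / ln (real n))"
proof -
  have "(\<Sum>j<k. if j = k - 1 then exp (- t) else 0) = exp (- t)"
    using assms by (subst sum.delta) auto
  moreover have "(\<lambda>n. \<Sum>j<k. (real n * (real (n - 1 choose j) * knn_threshold t n k ^ j *
        (1 - knn_threshold t n k) ^ (n - 1 - j)) - (if j = k - 1 then exp (- t) else 0)))
      \<in> O(\<lambda>n. ln (ln (real n)) / ln (real n))"
    using binomial_term_asymp[OF assms] by (intro big_sum_in_bigo) auto
  ultimately show ?thesis
    by (simp add: binomial_lower_tail_def sum_subtractf sum_distrib_left)
qed

section \<open>Measurability of distances and ball masses\<close>

text \<open>
  The type \<open>'a\<close> is not of class \<open>second_countable_topology\<close>, so the library's measurability of
  \<open>dist\<close> does not apply; separability is used through a countable dense set of intermediate points.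
\<close>

lemma borel_measurable_dist_separable:
  fixes f g :: "'b \<Rightarrow> 'a::metric_space"
  assumes "separable_space (euclidean :: 'a topology)"
    and [measurable]: "f \<in> N \<rightarrow>\<^sub>M borel" "g \<in> N \<rightarrow>\<^sub>M borel"
  shows "(\<lambda>x. dist (f x) (g x)) \<in> borel_measurable N"
proof -
  obtain C :: "'a set" where C: "countable C" "closure C = UNIV"
    using assms(1) by (auto simp: separable_space_def)
  have 1: "(\<exists>c\<in>C. dist y c + dist c z < r) \<longleftrightarrow> dist y z < r" for y z :: 'a and r
  proof
    assume "dist y z < r"
    \<comment> \<open>Half the slack, because the distance between \<open>c\<close> and
      \<open>y\<close> is spent twice: in \<open>dist y c\<close>, and in bounding
      \<open>dist c z\<close> by way of \<open>y\<close>.\<close>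
    then have "(r - dist y z) / 2 > 0" by simp
    then obtain c where "c \<in> C" "dist c y < (r - dist y z) / 2"
      using C(2) by (metis UNIV_I closure_approachable)
    then show "\<exists>c\<in>C. dist y c + dist c z < r"
      using dist_triangle[of c z y] by (intro bexI[of _ c]) (simp_all add: dist_commute field_simps)
  qed (meson dist_triangle le_less_trans)
  have [measurable]: "(\<lambda>y. dist y c) \<in> borel_measurable borel" "(\<lambda>y. dist c y) \<in> borel_measurable borel"
    for c :: 'a
    by (auto intro!: borel_measurable_continuous_onI continuous_intros)
  have "{x \<in> space N. dist (f x) (g x) < r} \<in> sets N" for r
  proof -
    have "{x \<in> space N. dist (f x) (g x) < r} = {x \<in> space N. \<exists>c\<in>C. dist (f x) c + dist c (g x) < r}"
      by (simp add: 1)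
    also have "\<dots> \<in> sets N"
      using C(1) by measurable
    finally show ?thesis .
  qed
  then show ?thesis
    by (simp add: borel_measurable_iff_less)
qed

text \<open>The ball is the section at \<open>x\<close> of a measurable set \<open>Q\<close> in the
  product of \<open>N\<close> and \<open>\<mu>\<close>, and the measure of a section depends
  measurably on \<open>x\<close>.\<close>

lemma borel_measurable_measure_cball:
  fixes f :: "'b \<Rightarrow> 'a::metric_space"
  assumes sep: "separable_space (euclidean :: 'a topology)"
    and "prob_space \<mu>" and sets_\<mu>: "sets \<mu> = sets borel"
    and [measurable]: "f \<in> N \<rightarrow>\<^sub>M borel" "r \<in> borel_measurable N"
  shows "(\<lambda>x. measure \<mu> (cball (f x) (r x))) \<in> borel_measurable N"
proof -
  interpret \<mu>: prob_space \<mu> by fact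
  note [measurable] = borel_measurable_dist_separable[OF sep]
  have [measurable]: "snd \<in> N \<Otimes>\<^sub>M \<mu> \<rightarrow>\<^sub>M borel"
    using measurable_snd[of N \<mu>] by (simp add: measurable_cong_sets[OF refl sets_\<mu>])
  define Q where "Q = {p \<in> space (N \<Otimes>\<^sub>M \<mu>). dist (f (fst p)) (snd p) \<le> r (fst p)}"
  have "Q \<in> sets (N \<Otimes>\<^sub>M \<mu>)"
    unfolding Q_def by measurable
  then have "(\<lambda>x. enn2real (emeasure \<mu> (Pair x -` Q))) \<in> borel_measurable N"
    by (intro measurable_compose[OF \<mu>.measurable_emeasure_Pair]) auto
  also have "?this \<longleftrightarrow> ?thesis"
    using sets_eq_imp_space_eq[OF sets_\<mu>]
    by (intro measurable_cong)
       (auto simp: measure_def Q_def space_pair_measure cball_def intro!: arg_cong[where f = "\<lambda>A. enn2real (emeasure \<mu> A)"])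
  finally show ?thesis .
qed

section \<open>Uniform law of the ball mass about a fixed centre\<close>

text \<open>The probability integral transform: \<open>F\<close>, the distribution function of the
  distance to \<open>y\<close>, is continuous because spheres are null. It may have flat pieces, so
  the sublevel set is identified through the largest \<open>s\<close> with
  \<open>F s = v\<close>.\<close>

lemma measure_sublevel_cball:
  fixes y :: "'a::metric_space"
  assumes "prob_space \<mu>" and sets_\<mu>: "sets \<mu> = sets borel"
    and sphere: "\<And>r. r \<ge> 0 \<Longrightarrow> measure \<mu> {z. dist y z = r} = 0"
    and v: "0 \<le> v" "v < 1"
  shows "measure \<mu> {z. measure \<mu> (cball y (dist y z)) \<le> v} = v"
proof -
  interpret \<mu>: prob_space \<mu> by fact
  have space_\<mu>: "space \<mu> = UNIV"
    using sets_eq_imp_space_eq[OF sets_\<mu>] by simp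
  have d: "dist y \<in> \<mu> \<rightarrow>\<^sub>M borel"
    unfolding measurable_cong_sets[OF sets_\<mu> refl]
    by (auto intro!: borel_measurable_continuous_onI continuous_intros)
  define D where "D = distr \<mu> borel (dist y)"
  interpret D: real_distribution D
    unfolding D_def by (rule \<mu>.real_distribution_distr[OF d])
  define F where "F = cdf D"
  have F: "F r = measure \<mu> (cball y r)" for r
    using d by (simp add: F_def D_def cdf_def measure_distr space_\<mu> cball_def vimage_def)
  have cont: "isCont F r" for r
  proof -
    have "measure D {r} = measure \<mu> {z. dist y z = r}"
      using d by (simp add: D_def measure_distr space_\<mu> vimage_def)
    also have "\<dots> = 0"
    proof (cases "r \<ge> 0")
      case False
      then have "{z. dist y z = r} = {}"
        using zero_le_dist[of y] by auto
      then show ?thesis by simp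
    qed (rule sphere)
    finally show ?thesis unfolding F_def D.isCont_cdf .
  qed
  have mono: "F a \<le> F b" if "a \<le> b" for a b
    using that unfolding F_def by (rule D.cdf_nondecreasing)
  have "eventually (\<lambda>r. F r > v) at_top"
    using order_tendstoD(1)[OF D.cdf_lim_at_top_prob v(2)] unfolding F_def .
  then obtain b where b: "F b > v" "b \<ge> 0"
    by (metis (no_types, lifting) eventually_at_top_linorder linorder_le_cases order_refl)
  have Fneg: "F (-1) = 0" by (simp add: F cball_empty)
  \<comment> \<open>A bounded window, so that a maximum exists: radius \<open>-1\<close> gives an
    empty ball and a start for the intermediate value theorem, while \<open>F b > v\<close> keeps
    every solution below \<open>b\<close>.\<close>
  define V where "V = {r. F r = v} \<inter> {-1..b}"
  have "closed V"
    unfolding V_def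
    by (intro closed_Int closed_Collect_eq continuous_intros continuous_at_imp_continuous_on) (auto simp: cont)
  then have "compact V"
    by (metis V_def compact_Icc compact_Int_closed inf_commute inf_left_idem closed_Int)
  moreover have "V \<noteq> {}"
    using IVT[of F "-1" v b] Fneg v b cont by (auto simp: V_def)
  ultimately obtain s where s: "s \<in> V" "\<And>r. r \<in> V \<Longrightarrow> r \<le> s"
    using compact_attains_sup[of V] by auto
  have Fs: "F s = v" using s(1) by (simp add: V_def)
  have "F r \<le> v \<longleftrightarrow> r \<le> s" for r
  proof
    assume "F r \<le> v"
    show "r \<le> s"
    proof (rule ccontr)
      assume "\<not> r \<le> s"
      then have "F r = v" using mono[of s r] Fs \<open>F r \<le> v\<close> by simp
      moreover have "r \<le> b"
        using mono[of b r] b(1) \<open>F r \<le> v\<close> by linarith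
      ultimately have "r \<in> V" using \<open>\<not> r \<le> s\<close> s(1) by (simp add: V_def)
      with s(2) \<open>\<not> r \<le> s\<close> show False by blast
    qed
  qed (use mono Fs in auto)
  then have "{z. measure \<mu> (cball y (dist y z)) \<le> v} = cball y s"
    unfolding F[symmetric] by (simp add: cball_def)
  then show ?thesis using F[of s] Fs by simp
qed

section \<open>From the neighbour distance to a count\<close>

text \<open>A downward closed property holds exactly on an initial segment of a sorted list, so
  \<open>filter\<close> and \<open>takeWhile\<close> agree.\<close>

lemma sorted_nth_downward_iff:
  fixes ys :: "'b::linorder list"
  assumes "sorted ys" "m < length ys" "\<And>a b. a \<le> b \<Longrightarrow> P b \<Longrightarrow> P a"
  shows "P (ys ! m) \<longleftrightarrow> m < length (filter P ys)"
proof -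
  have "filter P ys = takeWhile P ys"
    using assms(1,3)
  proof (induction ys)
    case (Cons y ys)
    show ?case
    proof (cases "P y")
      case False
      with Cons.prems have "filter P ys = []"
        by (auto simp: filter_empty_conv)
      with False show ?thesis by simp
    qed (use Cons in auto)
  qed simp
  moreover have "P (ys ! m) \<longleftrightarrow> m < length (takeWhile P ys)"
  proof
    assume "P (ys ! m)"
    then have "P (ys ! i)" if "i \<le> m" for i
      using assms sorted_nth_mono[OF assms(1) that] by blast
    then show "m < length (takeWhile P ys)"
      using assms(2) by (metis linorder_not_less nth_length_takeWhile order_le_less_trans)
  next
    assume "m < length (takeWhile P ys)"
    then show "P (ys ! m)" by (metis nth_mem set_takeWhileD takeWhile_nth)
  qed
  ultimately show ?thesis by simp
qed

text \<open>Having ball mass at most \<open>v\<close> is downward closed in the radius, so it holds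
  at list index \<open>k - 1\<close> iff at least \<open>k\<close> of the distances satisfy it; the
  claim is the negation. Ties do no harm, as list and set both run over the indices
  \<open>j\<close>.\<close>

lemma measure_cball_knn_dist_gt_iff:
  assumes "prob_space \<mu>" "sets \<mu> = sets borel" "i \<in> {1..n}" "1 \<le> k" "k < n"
  shows "measure \<mu> (cball (x i) (knn_dist x i n k)) > v \<longleftrightarrow>
    card {j \<in> {1..n} - {i}. measure \<mu> (cball (x i) (dist (x i) (x j))) \<le> v} < k"
proof -
  interpret prob_space \<mu> by fact
  define js where "js = filter (\<lambda>j. j \<noteq> i) [1..<Suc n]"
  define P where "P = (\<lambda>r. measure \<mu> (cball (x i) r) \<le> v)"
  have js: "set js = {1..n} - {i}" "distinct js"
    by (auto simp: js_def)
  then have "length js = n - 1"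
    using distinct_card[of js] assms(3) by simp
  have "P a" if "a \<le> b" "P b" for a b
    using that finite_measure_mono[OF subset_cball, of a b "x i"] assms(2)
    by (simp add: P_def)
  then have "P (knn_dist x i n k) \<longleftrightarrow> k - 1 < length (filter P (sort (map (\<lambda>j. dist (x i) (x j)) js)))"
    unfolding knn_dist_def js_def[symmetric]
    using assms(4,5) \<open>length js = n - 1\<close> by (intro sorted_nth_downward_iff) auto
  also have "length (filter P (sort (map (\<lambda>j. dist (x i) (x j)) js))) =
      length (filter (\<lambda>j. P (dist (x i) (x j))) js)"
    by (simp add: filter_sort filter_map o_def)
  also have "\<dots> = card {j \<in> {1..n} - {i}. P (dist (x i) (x j))}"
    using distinct_card[OF distinct_filter[OF js(2)], of "\<lambda>j. P (dist (x i) (x j))"]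
    unfolding set_filter js(1) by simp
  finally show ?thesis
    using assms(4) by (auto simp: P_def)
qed

section \<open>The binomial law of the number of near points\<close>

text \<open>The event is split by the exact set \<open>T\<close> of indices whose coordinates fall
  in \<open>G\<close>. Each piece is a box whose probability depends on \<open>card T\<close> only,
  and \<open>card J choose m\<close> of the sets have size \<open>m\<close>.\<close>

lemma measure_PiM_card_less:
  assumes "prob_space \<mu>" "finite J" and G: "G \<in> sets \<mu>"
  shows "measure (PiM J (\<lambda>_. \<mu>)) {x \<in> space (PiM J (\<lambda>_. \<mu>)). card {j \<in> J. x j \<in> G} < k}
    = binomial_lower_tail (card J) (measure \<mu> G) k"
proof -
  interpret \<mu>: prob_space \<mu> by fact
  interpret finite_product_prob_space "\<lambda>_. \<mu>" J
    by unfold_locales fact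
  define p where "p = measure \<mu> G"
  define S where "S = {T. T \<subseteq> J \<and> card T < k}"
  define A where "A = (\<lambda>T. PiE J (\<lambda>j. if j \<in> T then G else space \<mu> - G))"
  have "finite S" unfolding S_def using \<open>finite J\<close> by simp
  have A_iff: "x \<in> A T \<longleftrightarrow> x \<in> space (PiM J (\<lambda>_. \<mu>)) \<and> {j \<in> J. x j \<in> G} = T" if "T \<subseteq> J" for x T
    using that sets.sets_into_space[OF G]
    by (auto simp: A_def space_PiM PiE_iff split: if_splits)
  have A_sets: "A T \<in> sets (PiM J (\<lambda>_. \<mu>))" for T
    unfolding A_def using G \<open>finite J\<close> by (intro sets_PiM_I_finite) auto
  have A_prob: "prob (A T) = p ^ card T * (1 - p) ^ (card J - card T)" if "T \<subseteq> J" for T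
  proof -
    have "prob (A T) = (\<Prod>j\<in>J. if j \<in> T then p else 1 - p)"
      unfolding A_def p_def using G
      by (subst prob_times) (auto simp: \<mu>.prob_compl intro!: prod.cong)
    also have "\<dots> = p ^ card (J \<inter> T) * (1 - p) ^ card (J - T)"
      using \<open>finite J\<close> by (simp add: prod.If_cases Diff_eq)
    also have "\<dots> = p ^ card T * (1 - p) ^ (card J - card T)"
      using that \<open>finite J\<close> by (simp add: Int_absorb1 card_Diff_subset finite_subset)
    finally show ?thesis .
  qed
  have "{x \<in> space (PiM J (\<lambda>_. \<mu>)). card {j \<in> J. x j \<in> G} < k} = (\<Union>T\<in>S. A T)"
    by (auto simp: S_def A_iff)
  also have "prob \<dots> = (\<Sum>T\<in>S. prob (A T))"
    using \<open>finite S\<close> A_sets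
    by (intro finite_measure_finite_Union) (auto simp: disjoint_family_on_def S_def A_iff)
  also have "\<dots> = (\<Sum>T\<in>S. p ^ card T * (1 - p) ^ (card J - card T))"
    by (intro sum.cong) (auto simp: S_def A_prob)
  also have "\<dots> = (\<Sum>m<k. \<Sum>T\<in>{T\<in>S. card T = m}. p ^ card T * (1 - p) ^ (card J - card T))"
    using \<open>finite S\<close> by (intro sum.group[symmetric]) (auto simp: S_def)
  also have "\<dots> = binomial_lower_tail (card J) p k"
    unfolding binomial_lower_tail_def
  proof (intro sum.cong refl)
    fix m assume "m \<in> {..<k}"
    then have "{T\<in>S. card T = m} = {T. T \<subseteq> J \<and> card T = m}"
      by (auto simp: S_def)
    then have "card {T\<in>S. card T = m} = card J choose m"
      using n_subsets[OF \<open>finite J\<close>] by simp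
    then show "(\<Sum>T\<in>{T\<in>S. card T = m}. p ^ card T * (1 - p) ^ (card J - card T)) =
      real (card J choose m) * p ^ m * (1 - p) ^ (card J - m)"
      by simp
  qed
  finally show ?thesis by (simp add: p_def)
qed

text \<open>The centre's index \<open>i\<close> is kept apart from \<open>J\<close>, so that Fubini
  can fix the centre and integrate the other coordinates first.\<close>

definition few_near ::
    "'a::metric_space measure \<Rightarrow> nat set \<Rightarrow> nat \<Rightarrow> nat \<Rightarrow> real \<Rightarrow> (nat \<Rightarrow> 'a) set" where
  "few_near \<mu> J i k v = {x \<in> space (PiM (insert i J) (\<lambda>_. \<mu>)).
     card {j \<in> J. measure \<mu> (cball (x i) (dist (x i) (x j))) \<le> v} < k}"

context
  fixes \<mu> :: "'a::metric_space measure" and J :: "nat set" and i k :: nat and v :: real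
  assumes sep: "separable_space (euclidean :: 'a topology)"
    and \<mu>: "prob_space \<mu>" "sets \<mu> = sets borel"
    and J: "finite J" "i \<notin> J"
begin

text \<open>The bound on the cardinality becomes a finite disjunction over index sets
  \<open>T\<close> of finite conjunctions of measurable ball-mass comparisons.\<close>

lemma sets_few_near: "few_near \<mu> J i k v \<in> sets (PiM (insert i J) (\<lambda>_. \<mu>))"
proof -
  let ?P = "PiM (insert i J) (\<lambda>_. \<mu>)"
  have comp: "(\<lambda>x. x j) \<in> ?P \<rightarrow>\<^sub>M borel" if "j \<in> insert i J" for j
    using measurable_component_singleton[OF that, of "\<lambda>_. \<mu>"]
    by (simp add: measurable_cong_sets[OF refl \<mu>(2)])
  have [measurable]: "(\<lambda>x. measure \<mu> (cball (x i) (dist (x i) (x j)))) \<in> borel_measurable ?P"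
    if "j \<in> J" for j
    using that by (intro borel_measurable_measure_cball borel_measurable_dist_separable sep \<mu> comp) auto
  have "finite {T. T \<subseteq> J \<and> card T < k}" using J(1) by simp
  then have "{x \<in> space ?P. \<exists>T\<in>{T. T \<subseteq> J \<and> card T < k}. \<forall>j\<in>J.
      measure \<mu> (cball (x i) (dist (x i) (x j))) \<le> v \<longleftrightarrow> j \<in> T} \<in> sets ?P"
    using J(1) by measurable
  also have "{x \<in> space ?P. \<exists>T\<in>{T. T \<subseteq> J \<and> card T < k}. \<forall>j\<in>J.
      measure \<mu> (cball (x i) (dist (x i) (x j))) \<le> v \<longleftrightarrow> j \<in> T} = few_near \<mu> J i k v"
  proof -
    have "(\<exists>T\<in>{T. T \<subseteq> J \<and> card T < k}. \<forall>j\<in>J. P j \<longleftrightarrow> j \<in> T) \<longleftrightarrow> card {j \<in> J. P j} < k" for P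
    proof
      assume "\<exists>T\<in>{T. T \<subseteq> J \<and> card T < k}. \<forall>j\<in>J. P j \<longleftrightarrow> j \<in> T"
      then obtain T where "T \<subseteq> J" "card T < k" "{j \<in> J. P j} = T" by auto
      then show "card {j \<in> J. P j} < k" by simp
    qed (intro bexI[of _ "{j \<in> J. P j}"], auto)
    then show ?thesis by (simp add: few_near_def)
  qed
  finally show ?thesis .
qed

text \<open>Fubini with coordinate \<open>i\<close> outermost: for a fixed centre \<open>y\<close>
  each other point lies in \<open>G\<close> with probability \<open>v\<close> by
  \<open>measure_sublevel_cball\<close>, so the inner integral is the same for all \<open>y\<close>,
  and integrating over \<open>\<mu>\<close> leaves it unchanged.\<close>

lemma measure_few_near:
  assumes "\<And>x r. r \<ge> 0 \<Longrightarrow> measure \<mu> {y. dist x y = r} = 0" "0 \<le> v" "v < 1"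
  shows "measure (PiM (insert i J) (\<lambda>_. \<mu>)) (few_near \<mu> J i k v) = binomial_lower_tail (card J) v k"
proof -
  interpret \<mu>: prob_space \<mu> by fact
  interpret product_prob_space "\<lambda>_. \<mu>" by unfold_locales
  interpret J: prob_space "PiM J (\<lambda>_. \<mu>)" by (intro prob_space_PiM \<mu>)
  interpret iJ: prob_space "PiM (insert i J) (\<lambda>_. \<mu>)" by (intro prob_space_PiM \<mu>)
  have space_\<mu>: "space \<mu> = UNIV"
    using sets_eq_imp_space_eq[OF \<mu>(2)] by simp
  have inner: "(\<integral>\<^sup>+ x. indicator (few_near \<mu> J i k v) (x(i := y)) \<partial>PiM J (\<lambda>_. \<mu>))
      = ennreal (binomial_lower_tail (card J) v k)" for y
  proof -
    define G where "G = {z. measure \<mu> (cball y (dist y z)) \<le> v}"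
    have "(\<lambda>z. measure \<mu> (cball y (dist y z))) \<in> borel_measurable borel"
      by (intro borel_measurable_measure_cball borel_measurable_dist_separable sep \<mu>) auto
    then have "{z \<in> space borel. measure \<mu> (cball y (dist y z)) \<le> v} \<in> sets borel"
      by measurable
    then have "G \<in> sets \<mu>"
      by (simp add: G_def \<mu>(2))
    let ?E = "{x \<in> space (PiM J (\<lambda>_. \<mu>)). card {j \<in> J. x j \<in> G} < k}"
    have "indicator (few_near \<mu> J i k v) (x(i := y)) = (indicator ?E x :: ennreal)"
      if "x \<in> space (PiM J (\<lambda>_. \<mu>))" for x
    proof -
      have "x(i := y) \<in> space (PiM (insert i J) (\<lambda>_. \<mu>))"
        using that by (simp add: space_PiM space_\<mu> PiE_fun_upd)
      moreover have "{j \<in> J. measure \<mu> (cball ((x(i := y)) i) (dist ((x(i := y)) i) ((x(i := y)) j))) \<le> v}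
          = {j \<in> J. x j \<in> G}"
        using J(2) by (auto simp: G_def)
      ultimately show ?thesis
        using that by (simp add: few_near_def indicator_def)
    qed
    then have "(\<integral>\<^sup>+ x. indicator (few_near \<mu> J i k v) (x(i := y)) \<partial>PiM J (\<lambda>_. \<mu>))
        = (\<integral>\<^sup>+ x. indicator ?E x \<partial>PiM J (\<lambda>_. \<mu>))"
      by (rule nn_integral_cong)
    also have "\<dots> = emeasure (PiM J (\<lambda>_. \<mu>)) ?E"
    proof (intro nn_integral_indicator)
      have [measurable]: "Measurable.pred (PiM J (\<lambda>_. \<mu>)) (\<lambda>x. x j \<in> G)" if "j \<in> J" for j
        using \<open>G \<in> sets \<mu>\<close> that by measurable
      show "?E \<in> sets (PiM J (\<lambda>_. \<mu>))"
        using J(1) by measurable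
    qed
    also have "\<dots> = ennreal (binomial_lower_tail (card J) (measure \<mu> G) k)"
      unfolding J.emeasure_eq_measure
      by (subst measure_PiM_card_less[OF \<mu>(1) J(1) \<open>G \<in> sets \<mu>\<close>]) simp
    also have "measure \<mu> G = v"
      unfolding G_def by (intro measure_sublevel_cball \<mu> assms)
    finally show ?thesis .
  qed
  have "emeasure (PiM (insert i J) (\<lambda>_. \<mu>)) (few_near \<mu> J i k v)
      = (\<integral>\<^sup>+ x. indicator (few_near \<mu> J i k v) x \<partial>PiM (insert i J) (\<lambda>_. \<mu>))"
    using sets_few_near by simp
  also have "\<dots> = (\<integral>\<^sup>+ y. \<integral>\<^sup>+ x. indicator (few_near \<mu> J i k v) (x(i := y)) \<partial>PiM J (\<lambda>_. \<mu>) \<partial>\<mu>)"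
    using J sets_few_near by (intro product_nn_integral_insert_rev) auto
  also have "\<dots> = ennreal (binomial_lower_tail (card J) v k)"
    by (simp add: inner \<mu>.emeasure_space_1)
  finally have "ennreal (measure (PiM (insert i J) (\<lambda>_. \<mu>)) (few_near \<mu> J i k v))
      = ennreal (binomial_lower_tail (card J) v k)"
    by (simp add: iJ.emeasure_eq_measure)
  \<comment> \<open>\<open>ennreal\<close> sends all negative reals to 0, so it can be cancelled
    only between nonnegative values.\<close>
  moreover have "binomial_lower_tail (card J) v k \<ge> 0"
    using assms by (auto simp: binomial_lower_tail_def intro!: sum_nonneg)
  ultimately show ?thesis
    by (simp add: ennreal_inj)
qed

end

section \<open>The exact expectation and its limit\<close>

text \<open>Linearity reduces the count to \<open>n\<close> events, each the preimage under the
  sample \<open>Y\<close> of a set \<open>few_near\<close> with the other \<open>n - 1\<close>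
  indices as \<open>J\<close>; all have the same probability.\<close>

lemma expectation_exceedance_count:
  fixes X :: "nat \<Rightarrow> 'w \<Rightarrow> 'a::metric_space"
  assumes sep: "separable_space (euclidean :: 'a topology)"
    and "prob_space M"
    and indep: "prob_space.indep_vars M (\<lambda>_. borel) X {1..}"
    and distr: "\<And>i. i \<ge> 1 \<Longrightarrow> distr M borel (X i) = \<mu>"
    and sphere: "\<And>x r. r \<ge> 0 \<Longrightarrow> measure \<mu> {y. dist x y = r} = 0"
    and k: "1 \<le> k" "k < n"
    and v: "0 \<le> knn_threshold t n k" "knn_threshold t n k < 1"
  shows "(\<integral>\<omega>. exceedance_count \<mu> t (\<lambda>i. X i \<omega>) n k \<partial>M)
    = real n * binomial_lower_tail (n - 1) (knn_threshold t n k) k"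
proof -
  interpret prob_space M by fact
  have X: "X i \<in> M \<rightarrow>\<^sub>M borel" if "i \<ge> 1" for i
    using indep that by (auto simp: indep_vars_def)
  have sets_\<mu>: "sets \<mu> = sets borel"
    using distr[of 1] by auto
  have \<mu>: "prob_space \<mu>"
    using prob_space_distr[OF X[of 1]] distr[of 1] by simp
  define v where "v = knn_threshold t n k"
  define P where "P = PiM {1..n} (\<lambda>_. \<mu>)"
  \<comment> \<open>Restriction to \<open>{1..n}\<close> puts the sample into the extensional
    function space carrying \<open>P\<close>, where independence makes its law the product
    measure.\<close>
  define Y where "Y = (\<lambda>\<omega>. \<lambda>i\<in>{1..n}. X i \<omega>)"
  define E where "E = (\<lambda>i. few_near \<mu> ({1..n} - {i}) i k v)"
  have sets_P: "sets P = sets (PiM {1..n} (\<lambda>_. borel))"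
    unfolding P_def using sets_\<mu> by (intro sets_PiM_cong) auto
  have Y: "Y \<in> M \<rightarrow>\<^sub>M P"
    unfolding Y_def measurable_cong_sets[OF refl sets_P] by (intro measurable_restrict X) auto
  have "indep_vars (\<lambda>_. borel) X {1..n}"
    using indep by (rule indep_vars_subset) auto
  then have "distr M (PiM {1..n} (\<lambda>_. borel)) Y = PiM {1..n} (\<lambda>i. distr M borel (X i))"
    unfolding Y_def using k X by (subst (asm) indep_vars_iff_distr_eq_PiM') auto
  also have "\<dots> = P"
    unfolding P_def using distr by (intro PiM_cong) auto
  finally have law: "distr M P Y = P"
    using distr_cong[OF refl sets_P, of M Y Y] by simp
  have insert: "insert i ({1..n} - {i}) = {1..n}" if "i \<in> {1..n}" for i
    using that by auto
  have E_sets: "E i \<in> sets P" if "i \<in> {1..n}" for i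
    using sets_few_near[OF sep \<mu> sets_\<mu>, of "{1..n} - {i}" i k v]
    unfolding insert[OF that] P_def E_def by simp
  have E_prob: "measure P (E i) = binomial_lower_tail (n - 1) v k" if "i \<in> {1..n}" for i
    using measure_few_near[OF sep \<mu> sets_\<mu>, of "{1..n} - {i}" i v k] sphere v that
    unfolding insert[OF that] P_def E_def v_def by simp
  have "exceedance_count \<mu> t (\<lambda>i. X i \<omega>) n k = (\<Sum>i=1..n. indicator (Y -` E i \<inter> space M) \<omega>)"
    if \<omega>: "\<omega> \<in> space M" for \<omega>
    unfolding exceedance_count_def
  proof (intro sum.cong refl)
    fix i assume i: "i \<in> {1..n}"
    have "Y \<omega> \<in> space P"
      using Y \<omega> by (rule measurable_space)
    moreover have "{j \<in> {1..n} - {i}. measure \<mu> (cball (Y \<omega> i) (dist (Y \<omega> i) (Y \<omega> j))) \<le> v}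
        = {j \<in> {1..n} - {i}. measure \<mu> (cball (X i \<omega>) (dist (X i \<omega>) (X j \<omega>))) \<le> v}"
      using i by (auto simp: Y_def)
    ultimately have "Y \<omega> \<in> E i \<longleftrightarrow>
        card {j \<in> {1..n} - {i}. measure \<mu> (cball (X i \<omega>) (dist (X i \<omega>) (X j \<omega>))) \<le> v} < k"
      unfolding E_def few_near_def insert[OF i] P_def
      by simp
    then show "of_bool (measure \<mu> (cball (X i \<omega>) (knn_dist (\<lambda>i. X i \<omega>) i n k)) > knn_threshold t n k)
        = (indicator (Y -` E i \<inter> space M) \<omega> :: real)"
      using measure_cball_knn_dist_gt_iff[OF \<mu> sets_\<mu> i k, of v "\<lambda>i. X i \<omega>"] \<omega>
      by (simp add: v_def indicator_def)
  qed
  then have "(\<integral>\<omega>. exceedance_count \<mu> t (\<lambda>i. X i \<omega>) n k \<partial>M)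
      = (\<integral>\<omega>. (\<Sum>i=1..n. indicator (Y -` E i \<inter> space M) \<omega>) \<partial>M)"
    by (rule Bochner_Integration.integral_cong[OF refl])
  also have "\<dots> = (\<Sum>i=1..n. measure M (Y -` E i \<inter> space M))"
    using measurable_sets[OF Y E_sets]
    by (subst Bochner_Integration.integral_sum) (auto simp: emeasure_eq_measure)
  also have "\<dots> = (\<Sum>i=1..n. measure (distr M P Y) (E i))"
    by (intro sum.cong refl measure_distr[symmetric] Y E_sets)
  also have "\<dots> = real n * binomial_lower_tail (n - 1) v k"
    by (simp add: law E_prob)
  finally show ?thesis by (simp add: v_def)
qed

theorem theorem1p1:
  fixes M :: "'w measure"
    and X :: "nat \<Rightarrow> 'w \<Rightarrow> 'a::metric_space"
    and \<mu> :: "'a measure"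
    and k :: nat and t :: real
  assumes "separable_space (euclidean :: 'a topology)"
    and "prob_space M"
    and "prob_space.indep_vars M (\<lambda>_. borel) X {1..}"
    and "\<And>i. i \<ge> 1 \<Longrightarrow> distr M borel (X i) = \<mu>"
    and "\<And>x r. r \<ge> 0 \<Longrightarrow> measure \<mu> {y. dist x y = r} = 0"
    and "k \<ge> 1"
  shows "(\<lambda>n. (\<integral>\<omega>. exceedance_count \<mu> t (\<lambda>i. X i \<omega>) n k \<partial>M) - exp (- t))
           \<in> O(\<lambda>n. ln (ln (real n)) / ln (real n))"
proof -
  \<comment> \<open>The exact formula requires \<open>k < n\<close> and a threshold in [0, 1); both
    hold for all large \<open>n\<close>, which is enough for a bound at infinity.\<close>
  have "eventually (\<lambda>n. (\<integral>\<omega>. exceedance_count \<mu> t (\<lambda>i. X i \<omega>) n k \<partial>M) - exp (- t)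
      = real n * binomial_lower_tail (n - 1) (knn_threshold t n k) k - exp (- t)) sequentially"
    using eventually_gt_at_top[of k] knn_threshold_eventually[OF assms(6), of t]
    by eventually_elim (simp add: expectation_exceedance_count[OF assms])
  from landau_o.big.in_cong[OF this] show ?thesis
    using binomial_lower_tail_asymp[OF assms(6), of t] by simp
qed

end
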